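(* Let $K_1,\dots,K_N$ be a set of (not necessarily Hermitian) operators on a finite-dimensional Hilbert space. For any state $\rho$ on this space, $$\sum_{j=1}^{N}I(\rho,K_j)\geq\frac{1}{N}\,I\left(\rho,\sum_{j=1}^{N}K_j\right).$$
   Context: A state is a positive semidefinite operator of trace one. For a state $\rho$ and an arbitrary operator $K$, the generalized Wigner-Yanase skew information is $$I(\rho,K)=\frac12\mathrm{tr}\left([\sqrt\rho,K][\sqrt\rho,K]^{\dagger}\right)=\frac12\|[\sqrt\rho,K]\|_2^2,$$ where $[X,Y]=XY-YX$ and $\|X\|_2=(\mathrm{tr}\,XX^{\dagger})^{1/2}$. *)

theory Defs
  imports "HOL-Analysis.Analysis"
begin

text \<open>
  Operators on a finite-dimensional complex Hilbert space are matrices of type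
  \<^typ>\<open>complex ^ 'n ^ 'n\<close> with respect to an orthonormal basis indexed by \<open>'n\<close>.
\<close>

definition dagger :: "complex ^ 'n ^ 'n \<Rightarrow> complex ^ 'n ^ 'n" where
  "dagger A = (\<chi> i j. cnj (A $ j $ i))"

definition cinner_prod :: "complex ^ 'n \<Rightarrow> complex ^ 'n \<Rightarrow> complex" where
  "cinner_prod x y = (\<Sum>i\<in>UNIV. cnj (x $ i) * y $ i)"

definition positive_semidefinite :: "complex ^ 'n ^ 'n \<Rightarrow> bool" where
  "positive_semidefinite A \<longleftrightarrow>
     dagger A = A \<and> (\<forall>x. 0 \<le> Re (cinner_prod x (A *v x)))"

definition state :: "complex ^ 'n ^ 'n \<Rightarrow> bool" where
  "state \<rho> \<longleftrightarrow> positive_semidefinite \<rho> \<and> trace \<rho> = 1"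

text \<open>
  Only meaningful for positive semidefinite arguments, for which the positive
  semidefinite square root exists and is unique.
\<close>

definition op_sqrt :: "complex ^ 'n ^ 'n \<Rightarrow> complex ^ 'n ^ 'n" where
  "op_sqrt A = (THE S. positive_semidefinite S \<and> S ** S = A)"

definition commutator :: "complex ^ 'n ^ 'n \<Rightarrow> complex ^ 'n ^ 'n \<Rightarrow> complex ^ 'n ^ 'n" where
  "commutator X Y = X ** Y - Y ** X"

text \<open>
  The trace of \<open>X X\<^sup>\<dagger>\<close> is real and nonnegative (\<open>trace_mult_dagger\<close> below), so
  taking the real part loses nothing here and in the skew information.
\<close>

definition hs_norm :: "complex ^ 'n ^ 'n \<Rightarrow> real" where
  "hs_norm X = sqrt (Re (trace (X ** dagger X)))"

definition skew_information :: "complex ^ 'n ^ 'n \<Rightarrow> complex ^ 'n ^ 'n \<Rightarrow> real" where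
  "skew_information \<rho> K =
     1 / 2 * Re (trace (commutator (op_sqrt \<rho>) K ** dagger (commutator (op_sqrt \<rho>) K)))"

lemma trace_mult_dagger_sum:
  "trace (X ** dagger X) = complex_of_real (\<Sum>i\<in>UNIV. \<Sum>j\<in>UNIV. (cmod (X $ i $ j))\<^sup>2)"
  unfolding trace_def dagger_def matrix_matrix_mult_def
  by (simp add: complex_norm_square del: of_real_power)

lemma trace_mult_dagger:
  "trace (X ** dagger X) = complex_of_real ((hs_norm X)\<^sup>2)"
  unfolding hs_norm_def trace_mult_dagger_sum
  by (simp add: sum_nonneg)

lemma skew_information_hs_norm:
  "skew_information \<rho> K = 1 / 2 * (hs_norm (commutator (op_sqrt \<rho>) K))\<^sup>2"
  by (simp add: skew_information_def trace_mult_dagger)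

end

theory Submission
  imports Defs
begin

text \<open>For fixed \<open>\<rho>\<close>, the commutator with \<open>op_sqrt \<rho>\<close> is
  additive in its second argument (\<open>commutator_sum_right\<close>), so the operator sum yields
  a sum of N commutators. Half their squared Hilbert-Schmidt norms are the skew informations, so the
  claim reduces to: the squared norm of a sum of N matrices is at most N times the sum of their
  squared norms (\<open>hs_norm_sum_square_le\<close>).\<close>

lemma commutator_zero_right: "commutator X 0 = 0"
  by (simp add: commutator_def matrix_matrix_mult_def vec_eq_iff)

lemma commutator_add_right: "commutator X (Y + Z) = commutator X Y + commutator X Z"
  by (simp add: commutator_def matrix_matrix_mult_def vec_eq_iff sum.distrib algebra_simps)

lemma commutator_sum_right: "commutator X (\<Sum>a\<in>A. f a) = (\<Sum>a\<in>A. commutator X (f a))"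
  by (induction A rule: infinite_finite_induct)
    (simp_all add: commutator_zero_right commutator_add_right)

lemma hs_norm_square: "(hs_norm X)\<^sup>2 = (\<Sum>i\<in>UNIV. \<Sum>j\<in>UNIV. (cmod (X $ i $ j))\<^sup>2)"
  using trace_mult_dagger[of X] trace_mult_dagger_sum[of X] by (simp only: of_real_eq_iff)

text \<open>Triangle inequality, then Cauchy-Schwarz of the real vector of norms against the
  all-ones vector, which produces the factor \<open>card A\<close>.\<close>

lemma norm_sum_square_le:
  fixes f :: "'a \<Rightarrow> 'b::real_normed_vector"
  shows "(norm (\<Sum>a\<in>A. f a))\<^sup>2 \<le> real (card A) * (\<Sum>a\<in>A. (norm (f a))\<^sup>2)"
proof -
  have "(norm (\<Sum>a\<in>A. f a))\<^sup>2 \<le> (\<Sum>a\<in>A. norm (f a))\<^sup>2"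
    by (intro power_mono norm_sum norm_ge_zero)
  also have "\<dots> \<le> real (card A) * (\<Sum>a\<in>A. (norm (f a))\<^sup>2)"
    using sum_squared_le_sum_of_squares[of "\<lambda>a. norm (f a)" A] by (simp add: mult.commute)
  finally show ?thesis .
qed

text \<open>\<open>hs_norm\<close> is the Euclidean norm of the matrix entries, so the scalar bound
  is applied to each entry and summed.\<close>

lemma hs_norm_sum_square_le:
  "(hs_norm (\<Sum>a\<in>A. f a))\<^sup>2 \<le> real (card A) * (\<Sum>a\<in>A. (hs_norm (f a))\<^sup>2)"
proof -
  have "(hs_norm (\<Sum>a\<in>A. f a))\<^sup>2 = (\<Sum>i\<in>UNIV. \<Sum>j\<in>UNIV. (cmod (\<Sum>a\<in>A. f a $ i $ j))\<^sup>2)"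
    by (simp add: hs_norm_square sum_component)
  also have "\<dots> \<le> (\<Sum>i\<in>UNIV. \<Sum>j\<in>UNIV. real (card A) * (\<Sum>a\<in>A. (cmod (f a $ i $ j))\<^sup>2))"
    by (intro sum_mono norm_sum_square_le)
  also have "\<dots> = real (card A) * (\<Sum>i\<in>UNIV. \<Sum>j\<in>UNIV. \<Sum>a\<in>A. (cmod (f a $ i $ j))\<^sup>2)"
    by (simp add: sum_distrib_left)
  also have "\<dots> = real (card A) * (\<Sum>a\<in>A. (hs_norm (f a))\<^sup>2)"
    \<comment> \<open>Fixing the inner index set to \<open>A\<close> orients the swap: the sum over
      \<open>A\<close> only moves outwards, past \<open>j\<close> and then \<open>i\<close>.\<close>
    by (simp add: hs_norm_square sum.swap[of _ A])
  finally show ?thesis .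
qed

theorem lemma1:
  fixes K :: "nat \<Rightarrow> complex ^ 'n ^ 'n"
    and \<rho> :: "complex ^ 'n ^ 'n"
    and N :: nat
  assumes "N \<ge> 1"
    and "state \<rho>"
  shows "(\<Sum>j = 1..N. skew_information \<rho> (K j))
           \<ge> 1 / real N * skew_information \<rho> (\<Sum>j = 1..N. K j)"
proof -
  have "skew_information \<rho> (\<Sum>j = 1..N. K j) \<le> real N * (\<Sum>j = 1..N. skew_information \<rho> (K j))"
    using hs_norm_sum_square_le[of "\<lambda>j. commutator (op_sqrt \<rho>) (K j)" "{1..N}"]
    \<comment> \<open>The flipped rule pulls the common factor 1/2 out of the sum, so that it
      cancels on both sides.\<close>
    by (simp add: skew_information_hs_norm commutator_sum_right flip: sum_divide_distrib)
  with \<open>N \<ge> 1\<close> show ?thesis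
    by (simp add: field_simps)
qed

end
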